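(* Every i-measure has finite total semivariation. That is, if $E,F$ are Banach spaces, $\mathfrak{M}$ is a $\sigma$-algebra of subsets of a set $Z$ and $\mu\colon\mathfrak{M}\to\mathcal{L}(E,F)$ is an i-measure, then $\|\mu\|_Z<\infty$.
   Context: Banach spaces are over a fixed field $\mathbb{K}$ of real or complex numbers; $\mathcal{L}(E,F)$ is the Banach space of continuous linear operators $E\to F$. For $T_n\in\mathcal{L}(E,F)$, the series $\sum_{n=1}^\infty T_n$ is independently convergent if $\sum_{n=1}^\infty T_nx_n$ converges in the norm topology of $F$ for every bounded sequence $(x_n)$ in $E$. A set function $\mu\colon\mathfrak{M}\to\mathcal{L}(E,F)$ is an i-measure if for any sequence of pairwise disjoint sets $A_n\in\mathfrak{M}$, $\mu(\bigcup_n A_n)x=\sum_n\mu(A_n)x$ for each $x\in E$ and the series $\sum_n\mu(A_n)$ is independently convergent. The total semivariation of $\mu$ is $$\|\mu\|_Z=\sup\Bigl\{\Bigl\|\sum_{n=1}^N\mu(A_n)x_n\Bigr\| : N<\infty,\ A_n\in\mathfrak{M}\text{ pairwise disjoint},\ x_n\in E,\ \|x_n\|\le1\Bigr\}\in[0,\infty].$$ *)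

theory Defs
  imports "HOL-Analysis.Analysis"
begin

text \<open>
  Banach spaces over a scalar field that is either the reals or the complex numbers. The
  distribution has a type class only for real Banach spaces, so scalar multiplication by the field
  \<open>'k\<close> is an explicit operation that extends the real one. Both \<^typ>\<open>real\<close> and
  \<^typ>\<open>complex\<close> are instances of \<^class>\<open>real_normed_field\<close>; by the Gelfand-Mazur theorem
  there are no others up to isometric isomorphism.
\<close>

definition banach_space_over ::
    "('k::real_normed_field \<Rightarrow> 'a::banach \<Rightarrow> 'a) \<Rightarrow> bool" where
  "banach_space_over s \<longleftrightarrow>
     vector_space s \<and>
     (\<forall>r x. s (of_real r) x = r *\<^sub>R x) \<and>
     (\<forall>c x. norm (s c x) = norm c * norm x)"

lemma banach_space_over_real: "banach_space_over (scaleR :: real \<Rightarrow> 'a::banach \<Rightarrow> 'a)"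
  unfolding banach_space_over_def
  by (simp add: real_vector.vector_space_axioms)

lemma banach_space_over_complex: "banach_space_over ((*) :: complex \<Rightarrow> complex \<Rightarrow> complex)"
  unfolding banach_space_over_def vector_space_def
  by (simp add: algebra_simps norm_mult scaleR_conv_of_real)

text \<open>
  A \<open>'k\<close>-linear operator is in particular real-linear, and its operator norm does not depend on
  the scalar field. Hence the \<open>'k\<close>-linear continuous operators form a subset of the type of real
  bounded linear operators, and all of that type if \<open>'k\<close> is \<^typ>\<open>real\<close>.
\<close>

definition operators_over ::
    "('k::real_normed_field \<Rightarrow> 'a::banach \<Rightarrow> 'a) \<Rightarrow> ('k \<Rightarrow> 'b::banach \<Rightarrow> 'b)
      \<Rightarrow> ('a \<Rightarrow>\<^sub>L 'b) set" where
  "operators_over s t = {T. Vector_Spaces.linear s t (blinfun_apply T)}"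

lemma operators_over_real:
  "operators_over scaleR scaleR = (UNIV :: ('a::banach \<Rightarrow>\<^sub>L 'b::banach) set)"
  by (auto simp: operators_over_def linear_def[symmetric]
      intro: bounded_linear.linear blinfun.bounded_linear_right)

definition independently_convergent :: "(nat \<Rightarrow> 'a::banach \<Rightarrow>\<^sub>L 'b::banach) \<Rightarrow> bool" where
  "independently_convergent T \<longleftrightarrow>
     (\<forall>x. bounded (range x) \<longrightarrow> summable (\<lambda>n. blinfun_apply (T n) (x n)))"

definition i_measure ::
    "('k::real_normed_field \<Rightarrow> 'a::banach \<Rightarrow> 'a) \<Rightarrow> ('k \<Rightarrow> 'b::banach \<Rightarrow> 'b)
      \<Rightarrow> 'z set set \<Rightarrow> ('z set \<Rightarrow> 'a \<Rightarrow>\<^sub>L 'b) \<Rightarrow> bool" where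
  "i_measure s t M \<mu> \<longleftrightarrow>
     (\<forall>A\<in>M. \<mu> A \<in> operators_over s t) \<and>
     (\<forall>A :: nat \<Rightarrow> 'z set. range A \<subseteq> M \<and> disjoint_family A \<longrightarrow>
        (\<forall>x. (\<lambda>n. blinfun_apply (\<mu> (A n)) x) sums blinfun_apply (\<mu> (\<Union>n. A n)) x) \<and>
        independently_convergent (\<lambda>n. \<mu> (A n)))"

definition total_semivariation ::
    "'z set set \<Rightarrow> ('z set \<Rightarrow> 'a::banach \<Rightarrow>\<^sub>L 'b::banach) \<Rightarrow> ennreal" where
  "total_semivariation M \<mu> =
     Sup {ennreal (norm (\<Sum>n<N. blinfun_apply (\<mu> (A n)) (x n))) | (N :: nat) A x.
       (\<forall>n<N. A n \<in> M) \<and> disjoint_family_on A {..<N} \<and> (\<forall>n<N. norm (x n) \<le> 1)}"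

end

theory Submission
  imports Defs
begin

text \<open>
  Call a set \<open>A\<close> unbounded if the sums defining its semivariation are unbounded in norm. The key step
  is that every unbounded \<open>A\<close> contains an unbounded \<open>B\<close> such that \<open>A - B\<close> carries a sum of norm
  greater than 1: in a sum over \<open>A\<close> of norm greater than \<open>norm (\<mu> A) + 2\<close>, some set \<open>B\<close> of the sum (or
  the remainder of \<open>A\<close>) is unbounded, and either the other terms or \<open>\<mu> (A - B)\<close> must be large.
  Iterating from \<open>Z\<close> yields disjoint sets \<open>R\<^sub>0, R\<^sub>1, \<dots>\<close>, each carrying such a sum; listing all terms of
  these sums one after another gives a series that violates independent convergence.
\<close>

section \<open>Semivariation sums of a set and their boundedness on finite unions\<close>

text \<open>The vectors themselves are collected, not their norms, so that sums can be split and
  added. Arbitrary finite index sets \<open>I\<close> allow a term to be dropped without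
  reindexing.\<close>

definition semivariation_sums ::
    "'z set set \<Rightarrow> ('z set \<Rightarrow> 'a::banach \<Rightarrow>\<^sub>L 'b::banach) \<Rightarrow> 'z set \<Rightarrow> 'b set" where
  "semivariation_sums M \<mu> R =
     {\<Sum>i\<in>I. blinfun_apply (\<mu> (A i)) (x i) | (I :: nat set) A x.
       finite I \<and> (\<forall>i\<in>I. A i \<in> M \<and> A i \<subseteq> R \<and> norm (x i) \<le> 1) \<and> disjoint_family_on A I}"

lemma semivariation_sumsI:
  assumes "finite (I :: nat set)" "\<And>i. i \<in> I \<Longrightarrow> A i \<in> M" "\<And>i. i \<in> I \<Longrightarrow> A i \<subseteq> R"
    "\<And>i. i \<in> I \<Longrightarrow> norm (x i) \<le> 1" "disjoint_family_on A I"
  shows "(\<Sum>i\<in>I. blinfun_apply (\<mu> (A i)) (x i)) \<in> semivariation_sums M \<mu> R"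
  unfolding semivariation_sums_def using assms by blast

lemma semivariation_sumsE:
  assumes "v \<in> semivariation_sums M \<mu> R"
  obtains I :: "nat set" and A x where
    "v = (\<Sum>i\<in>I. blinfun_apply (\<mu> (A i)) (x i))" "finite I" "\<And>i. i \<in> I \<Longrightarrow> A i \<in> M"
    "\<And>i. i \<in> I \<Longrightarrow> A i \<subseteq> R" "\<And>i. i \<in> I \<Longrightarrow> norm (x i) \<le> 1" "disjoint_family_on A I"
  using assms unfolding semivariation_sums_def by blast

lemma semivariation_sums_single:
  assumes "A \<in> M" "norm x \<le> 1"
  shows "blinfun_apply (\<mu> A) x \<in> semivariation_sums M \<mu> A"
  using semivariation_sumsI[of "{0}" "\<lambda>_. A" M A "\<lambda>_. x" \<mu>] assms
  by (simp add: disjoint_family_on_def)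

text \<open>Each set of the sum is cut along \<open>B\<close>: the part outside \<open>B\<close>
  lies in \<open>C\<close>, both families of parts stay disjoint, and the vectors \<open>x i\<close>
  are kept.\<close>

lemma semivariation_sums_Un:
  assumes M: "algebra Z M"
    and additive: "additive M \<mu>"
    and BC: "B \<in> M" "C \<in> M"
    and v: "v \<in> semivariation_sums M \<mu> (B \<union> C)"
  shows "\<exists>b\<in>semivariation_sums M \<mu> B. \<exists>c\<in>semivariation_sums M \<mu> C. v = b + c"
proof -
  interpret algebra Z M by (rule M)
  obtain I :: "nat set" and A x where *:
    "v = (\<Sum>i\<in>I. blinfun_apply (\<mu> (A i)) (x i))" "finite I" "\<And>i. i \<in> I \<Longrightarrow> A i \<in> M"
    "\<And>i. i \<in> I \<Longrightarrow> A i \<subseteq> B \<union> C" "\<And>i. i \<in> I \<Longrightarrow> norm (x i) \<le> 1" "disjoint_family_on A I"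
    using v by (rule semivariation_sumsE) blast
  have "\<mu> (A i) = \<mu> (A i \<inter> B) + \<mu> (A i - B)" if "i \<in> I" for i
    using additiveD[OF additive, of "A i \<inter> B" "A i - B"] *(3)[OF that] BC
    by (auto simp: Int_Diff_Un Int_Diff_disjoint)
  then have "v = (\<Sum>i\<in>I. blinfun_apply (\<mu> (A i \<inter> B)) (x i))
      + (\<Sum>i\<in>I. blinfun_apply (\<mu> (A i - B)) (x i))"
    by (simp add: *(1) sum.distrib[symmetric] blinfun.add_left)
  moreover have "(\<Sum>i\<in>I. blinfun_apply (\<mu> (A i \<inter> B)) (x i)) \<in> semivariation_sums M \<mu> B"
    using * BC by (intro semivariation_sumsI) (auto simp: disjoint_family_on_def disjoint_iff)
  moreover have "(\<Sum>i\<in>I. blinfun_apply (\<mu> (A i - B)) (x i)) \<in> semivariation_sums M \<mu> C"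
    using * BC by (intro semivariation_sumsI) (auto simp: disjoint_family_on_def disjoint_iff)
  ultimately show ?thesis by blast
qed

lemma bounded_semivariation_sums_Un:
  assumes "algebra Z M"
    and "additive M \<mu>"
    and "B \<in> M" "C \<in> M"
    and "bounded (semivariation_sums M \<mu> B)" "bounded (semivariation_sums M \<mu> C)"
  shows "bounded (semivariation_sums M \<mu> (B \<union> C))"
proof (rule bounded_subset)
  show "bounded {b + c | b c. b \<in> semivariation_sums M \<mu> B \<and> c \<in> semivariation_sums M \<mu> C}"
    using bounded_plus[OF assms(5,6)] by (rule bounded_subset) auto
qed (use semivariation_sums_Un[OF assms(1-4)] in blast)

lemma bounded_semivariation_sums_UN:
  assumes "algebra Z M"
    and "additive M \<mu>"
    and "finite I" "\<And>i. i \<in> I \<Longrightarrow> A i \<in> M"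
    and "\<And>i. i \<in> I \<Longrightarrow> bounded (semivariation_sums M \<mu> (A i))"
  shows "bounded (semivariation_sums M \<mu> (\<Union>i\<in>I. A i))"
  using assms(3-)
proof (induction I rule: finite_induct)
  case empty
  interpret algebra Z M by fact
  have "\<mu> {} = 0"
    using additiveD[OF assms(2), of "{}" "{}"] by simp
  then have "semivariation_sums M \<mu> {} \<subseteq> {0}"
    by (auto elim!: semivariation_sumsE intro!: sum.neutral)
  then show ?case
    by (simp add: bounded_subset[of "{0}"])
next
  case (insert i I)
  interpret algebra Z M by fact
  have "bounded (semivariation_sums M \<mu> (A i \<union> (\<Union>i\<in>I. A i)))"
    using insert by (intro bounded_semivariation_sums_Un[OF assms(1,2)]) auto
  then show ?case by simp
qed

section \<open>Splitting an unbounded set\<close>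

lemma unbounded_semivariation_sums_split:
  assumes M: "algebra Z M"
    and additive: "additive M \<mu>"
    and A: "A \<in> M" and unbounded: "\<not> bounded (semivariation_sums M \<mu> A)"
  shows "\<exists>B\<in>M. B \<subseteq> A \<and> \<not> bounded (semivariation_sums M \<mu> B) \<and>
    (\<exists>v\<in>semivariation_sums M \<mu> (A - B). norm v > 1)"
proof (rule ccontr)
  assume "\<not> ?thesis"
  then have small: "norm v \<le> 1"
    if "B \<in> M" "B \<subseteq> A" "\<not> bounded (semivariation_sums M \<mu> B)" "v \<in> semivariation_sums M \<mu> (A - B)"
    for B v
    using that by force
  interpret algebra Z M by (rule M)
  \<comment> \<open>The 2 pays for two applications of \<open>small\<close>: to the terms other than
    a chosen one \<open>D j\<close>, and to \<open>\<mu> (A - D j)\<close> at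
    \<open>x j\<close>.\<close>
  obtain v where v: "v \<in> semivariation_sums M \<mu> A" "norm v > norm (\<mu> A) + 2"
    using unbounded unfolding bounded_iff by (meson not_le)
  obtain I :: "nat set" and D x where *:
    "v = (\<Sum>i\<in>I. blinfun_apply (\<mu> (D i)) (x i))" "finite I" "\<And>i. i \<in> I \<Longrightarrow> D i \<in> M"
    "\<And>i. i \<in> I \<Longrightarrow> D i \<subseteq> A" "\<And>i. i \<in> I \<Longrightarrow> norm (x i) \<le> 1" "disjoint_family_on D I"
    using v(1) by (rule semivariation_sumsE) blast
  define U where "U = (\<Union>i\<in>I. D i)"
  have U: "U \<in> M" "U \<subseteq> A"
    using * by (auto simp: U_def)
  \<comment> \<open>Since \<open>A - (A - U) = U\<close> carries the large sum \<open>v\<close>, an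
    unbounded \<open>A - U\<close> would contradict \<open>small\<close>. So the unboundedness of
    \<open>A\<close> passes to \<open>U\<close>, and from there to some \<open>D j\<close>.\<close>
  have "v \<in> semivariation_sums M \<mu> (A - (A - U))"
    unfolding *(1) using * by (intro semivariation_sumsI) (auto simp: U_def)
  moreover have "norm v > 1"
    using v(2) norm_ge_zero[of "\<mu> A"] by linarith
  ultimately have "bounded (semivariation_sums M \<mu> (A - U))"
    using small[of "A - U" v] A U by force
  moreover have "U \<union> (A - U) = A" using U by blast
  ultimately have "\<not> bounded (semivariation_sums M \<mu> U)"
    using bounded_semivariation_sums_Un[OF M additive, of U "A - U"] A U unbounded by auto
  moreover have "bounded (semivariation_sums M \<mu> U)"
    if "\<And>j. j \<in> I \<Longrightarrow> bounded (semivariation_sums M \<mu> (D j))"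
    unfolding U_def using * that by (intro bounded_semivariation_sums_UN[OF M additive]) auto
  ultimately obtain j where j: "j \<in> I" "\<not> bounded (semivariation_sums M \<mu> (D j))"
    by blast
  have Dj: "D j \<in> M" "D j \<subseteq> A" using * j by auto
  have "(\<Sum>i\<in>I - {j}. blinfun_apply (\<mu> (D i)) (x i)) \<in> semivariation_sums M \<mu> (A - D j)"
  proof (intro semivariation_sumsI)
    show "D i \<subseteq> A - D j" if "i \<in> I - {j}" for i
      using * j(1) that disjoint_family_onD[of D I i j] by blast
  qed (use * in \<open>auto simp: disjoint_family_on_def\<close>)
  then have rest: "norm (\<Sum>i\<in>I - {j}. blinfun_apply (\<mu> (D i)) (x i)) \<le> 1"
    using small Dj j(2) by blast
  have "D j \<union> (A - D j) = A" using Dj by blast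
  then have "\<mu> A = \<mu> (D j) + \<mu> (A - D j)"
    using additiveD[OF additive, of "D j" "A - D j"] A Dj by auto
  \<comment> \<open>The term of \<open>D j\<close> is estimated through the complement, because
    \<open>small\<close> says nothing about sums over \<open>D j\<close> itself.\<close>
  then have "blinfun_apply (\<mu> (D j)) (x j)
      = blinfun_apply (\<mu> A) (x j) - blinfun_apply (\<mu> (A - D j)) (x j)"
    by (simp add: blinfun.add_left)
  moreover have "norm (blinfun_apply (\<mu> (A - D j)) (x j)) \<le> 1"
    using small[OF Dj j(2)] semivariation_sums_single[of "A - D j" M "x j" \<mu>] A Dj *(5) j(1) by auto
  moreover have "norm (blinfun_apply (\<mu> A) (x j)) \<le> norm (\<mu> A)"
    using norm_blinfun[of "\<mu> A" "x j"] mult_left_le[of "norm (x j)" "norm (\<mu> A)"] *(5) j(1) by force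
  ultimately have "norm (blinfun_apply (\<mu> (D j)) (x j)) \<le> norm (\<mu> A) + 1"
    using norm_triangle_ineq4[of "blinfun_apply (\<mu> A) (x j)" "blinfun_apply (\<mu> (A - D j)) (x j)"]
    by simp
  then have "norm (blinfun_apply (\<mu> (D j)) (x j) + (\<Sum>i\<in>I - {j}. blinfun_apply (\<mu> (D i)) (x i)))
      \<le> (norm (\<mu> A) + 1) + 1"
    using rest by (rule norm_triangle_mono)
  then have "norm v \<le> norm (\<mu> A) + 2"
    using *(1,2) j(1) by (simp add: sum.remove)
  then show False
    using v(2) by simp
qed

section \<open>Consequence of independent convergence for disjoint sets\<close>

text \<open>The sums \<open>v k\<close> become consecutive blocks of one series with disjoint sets
  and bounded vectors. That series converges, so its blocks tend to 0 by the Cauchy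
  criterion.\<close>

lemma semivariation_sums_tendsto_0:
  assumes "{} \<in> M"
    and indep: "\<forall>A :: nat \<Rightarrow> 'z set. range A \<subseteq> M \<and> disjoint_family A \<longrightarrow>
      independently_convergent (\<lambda>n. \<mu> (A n))"
    and R: "disjoint_family R"
    and v: "\<And>k. v k \<in> semivariation_sums M \<mu> (R k)"
  shows "v \<longlonglongrightarrow> 0"
proof -
  have "\<forall>k. \<exists>I A x. v k = (\<Sum>i\<in>I. blinfun_apply (\<mu> (A i)) (x i)) \<and> finite (I :: nat set) \<and>
     (\<forall>i\<in>I. A i \<in> M \<and> A i \<subseteq> R k \<and> norm (x i) \<le> 1) \<and> disjoint_family_on A I"
    using v unfolding semivariation_sums_def by auto
  then obtain I A x where "\<forall>k. v k = (\<Sum>i\<in>I k. blinfun_apply (\<mu> (A k i)) (x k i)) \<and>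
     finite (I k :: nat set) \<and> (\<forall>i\<in>I k. A k i \<in> M \<and> A k i \<subseteq> R k \<and> norm (x k i) \<le> 1) \<and>
     disjoint_family_on (A k) (I k)"
    unfolding choice_iff by (elim exE that)
  then have *: "\<And>k. v k = (\<Sum>i\<in>I k. blinfun_apply (\<mu> (A k i)) (x k i))"
    and fin: "\<And>k. finite (I k)"
    and Ax: "\<And>k i. i \<in> I k \<Longrightarrow> A k i \<in> M \<and> A k i \<subseteq> R k \<and> norm (x k i) \<le> 1"
    and disj: "\<And>k. disjoint_family_on (A k) (I k)"
    by auto
  \<comment> \<open>Block \<open>k\<close> gets length \<open>Suc (m k)\<close>, never 0. This
    yields \<open>k \<le> S k\<close>, so the starting positions \<open>S k\<close> of the blocks
    tend to infinity.\<close>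
  have "\<exists>m. I k \<subseteq> {..<Suc m}" for k
    using fin[of k] finite_nat_iff_bounded by (metis lessThan_Suc_atMost finite_nat_iff_bounded_le)
  then obtain m where m: "\<And>k. I k \<subseteq> {..<Suc (m k)}"
    by metis
  define S where "S k = (\<Sum>j<k. Suc (m j))" for k
  have S_Suc: "S (Suc k) = S k + Suc (m k)" for k
    by (simp add: S_def)
  have S_ge: "k \<le> S k" for k
    by (induction k) (auto simp: S_Suc)
  have S_mono: "S j \<le> S k" if "j \<le> k" for j k
    by (rule lift_Suc_mono_le[OF _ that]) (simp add: S_Suc)
  \<comment> \<open>Position \<open>n\<close> of the series lies in block \<open>b n\<close>, at
    offset \<open>p n\<close>.\<close>
  define b where "b n = (LEAST k. n < S (Suc k))" for n
  have b_eq: "b n = k" if "S k \<le> n" "n < S (Suc k)" for n k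
    unfolding b_def
  proof (rule Least_equality)
    show "k \<le> j" if "n < S (Suc j)" for j
      using S_mono[of "Suc j" k] that \<open>S k \<le> n\<close> by linarith
  qed fact
  have b_lower: "S (b n) \<le> n" for n
  proof (cases "b n")
    case (Suc j)
    then have "\<not> n < S (Suc j)"
      unfolding b_def by (metis lessI not_less_Least)
    then show ?thesis using Suc by simp
  qed (simp add: S_def)
  define p where "p n = n - S (b n)" for n
  \<comment> \<open>Offsets outside the index set are padded: the empty set keeps the family
    disjoint and within \<open>M\<close>, and the zero vector makes the term vanish.\<close>
  define A' where "A' n = (if p n \<in> I (b n) then A (b n) (p n) else {})" for n
  define x' where "x' n = (if p n \<in> I (b n) then x (b n) (p n) else 0)" for n
  \<comment> \<open>By \<open>b_lower\<close> the subtraction in \<open>p n\<close> is not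
    truncated, so \<open>n = S (b n) + p n\<close>.\<close>
  have inj: "n = n'" if "b n = b n'" "p n = p n'" for n n'
    using that b_lower[of n] b_lower[of n'] by (simp add: p_def)
  have "disjoint_family A'"
    unfolding disjoint_family_on_def
  proof (intro ballI impI)
    fix n n' :: nat assume "n \<noteq> n'"
    show "A' n \<inter> A' n' = {}"
    proof (cases "p n \<in> I (b n) \<and> p n' \<in> I (b n')")
      case True
      show ?thesis
      proof (cases "b n = b n'")
        case eq: True
        then have "p n \<noteq> p n'" using inj \<open>n \<noteq> n'\<close> by blast
        then show ?thesis
          using disj[of "b n"] True eq by (auto simp: A'_def disjoint_family_on_def)
      next
        case False
        then have "R (b n) \<inter> R (b n') = {}"
          using R by (auto simp: disjoint_family_on_def)
        then show ?thesis
          using Ax True by (fastforce simp: A'_def)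
      qed
    qed (auto simp: A'_def)
  qed
  moreover have "range A' \<subseteq> M"
    using Ax \<open>{} \<in> M\<close> by (auto simp: A'_def)
  moreover have "bounded (range x')"
    using Ax by (auto simp: x'_def bounded_iff intro!: exI[of _ 1])
  ultimately have summable: "summable (\<lambda>n. blinfun_apply (\<mu> (A' n)) (x' n))"
    using indep unfolding independently_convergent_def by blast
  have block: "v k = (\<Sum>n=S k..<S (Suc k). blinfun_apply (\<mu> (A' n)) (x' n))" for k
  proof -
    have "(\<Sum>n=S k..<S (Suc k). blinfun_apply (\<mu> (A' n)) (x' n))
        = (\<Sum>i<Suc (m k). blinfun_apply (\<mu> (A' (S k + i))) (x' (S k + i)))"
      by (simp only: S_Suc sum.atLeastLessThan_shift_0[of _ "S k"] add_diff_cancel_left'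
          atLeast0LessThan)
        (simp add: comp_def add.commute)
    also have "\<dots> = (\<Sum>i<Suc (m k). if i \<in> I k then blinfun_apply (\<mu> (A k i)) (x k i) else 0)"
    proof (rule sum.cong[OF refl])
      fix i assume "i \<in> {..<Suc (m k)}"
      then have "b (S k + i) = k"
        by (intro b_eq) (auto simp: S_Suc)
      then show "blinfun_apply (\<mu> (A' (S k + i))) (x' (S k + i))
          = (if i \<in> I k then blinfun_apply (\<mu> (A k i)) (x k i) else 0)"
        by (simp add: A'_def x'_def p_def)
    qed
    also have "\<dots> = v k"
      using m[of k] by (simp add: * sum.inter_restrict[symmetric] Int_absorb1 del: sum.lessThan_Suc)
    finally show ?thesis by simp
  qed
  show ?thesis
  proof (rule LIMSEQ_I)
    fix e :: real assume "e > 0"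
    then obtain N where "\<And>m n. m \<ge> N \<Longrightarrow> norm (\<Sum>n=m..<n. blinfun_apply (\<mu> (A' n)) (x' n)) < e"
      using summable unfolding summable_Cauchy by blast
    then have "norm (v k - 0) < e" if "k \<ge> N" for k
      using that S_ge[of k] block[of k] by auto
    then show "\<exists>N. \<forall>k\<ge>N. norm (v k - 0) < e" by blast
  qed
qed

section \<open>Boundedness by iterated splitting\<close>

lemma bounded_semivariation_sums:
  assumes M: "algebra Z M"
    and additive: "additive M \<mu>"
    and indep: "\<forall>A :: nat \<Rightarrow> 'z set. range A \<subseteq> M \<and> disjoint_family A \<longrightarrow>
      independently_convergent (\<lambda>n. \<mu> (A n))"
  shows "bounded (semivariation_sums M \<mu> Z)"
proof (rule ccontr)
  assume unbounded: "\<not> bounded (semivariation_sums M \<mu> Z)"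
  interpret algebra Z M by (rule M)
  let ?P = "\<lambda>B. B \<in> M \<and> \<not> bounded (semivariation_sums M \<mu> B)"
  let ?Q = "\<lambda>A B. B \<subseteq> A \<and> (\<exists>v\<in>semivariation_sums M \<mu> (A - B). norm v > 1)"
  \<comment> \<open>Dependent choice: \<open>Z\<close> shows that a chain can start, and the
    splitting lemma continues it because its \<open>B\<close> is again unbounded.\<close>
  obtain B where B: "\<And>k. ?P (B k)" "\<And>k. ?Q (B k) (B (Suc k))"
    using dependent_nat_choice[of "\<lambda>_. ?P" "\<lambda>_. ?Q"] unbounded top
      unbounded_semivariation_sums_split[OF M additive] by metis
  then obtain v where v: "\<And>k. v k \<in> semivariation_sums M \<mu> (B k - B (Suc k))" "\<And>k. norm (v k) > 1"
    by metis
  have "decseq B" using B(2) by (simp add: decseq_Suc_iff)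
  \<comment> \<open>For \<open>j < k\<close> the difference \<open>B k - B (Suc k)\<close> lies in
    \<open>B (Suc j)\<close>, which was removed from \<open>B j\<close>; hence the differences are
    disjoint.\<close>
  then have "B (Suc j) \<supseteq> B k" if "j < k" for j k
    using that by (simp add: decseqD)
  then have "disjoint_family (\<lambda>k. B k - B (Suc k))"
    unfolding disjoint_family_on_def by (fastforce simp: neq_iff)
  then have "v \<longlonglongrightarrow> 0"
    using semivariation_sums_tendsto_0[OF _ indep _ v(1)] by simp
  then obtain k where "norm (v k - 0) < 1"
    using LIMSEQ_D[of v 0 1] by auto
  then show False using v(2)[of k] by simp
qed

section \<open>Finite additivity of i-measures\<close>

text \<open>For the constant sequence of empty sets the series has constant terms, and it converges
  only if they are 0.\<close>

lemma i_measure_empty: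
  assumes "i_measure s t M \<mu>" "{} \<in> M"
  shows "\<mu> {} = 0"
proof (rule blinfun_eqI)
  fix x
  have "disjoint_family (\<lambda>_::nat. {})" by (simp add: disjoint_family_on_def)
  then have "(\<lambda>n::nat. blinfun_apply (\<mu> {}) x) sums blinfun_apply (\<mu> (\<Union>n::nat. {})) x"
    using assms unfolding i_measure_def by fastforce
  then show "blinfun_apply (\<mu> {}) x = blinfun_apply 0 x"
    using sums_summable summable_const_iff by fastforce
qed

text \<open>Countable additivity is applied to \<open>A, B, {}, {}, ...\<close>, where only the
  first two terms can be nonzero.\<close>

lemma i_measure_additive:
  assumes \<mu>: "i_measure s t M \<mu>" and M: "{} \<in> M"
  shows "additive M \<mu>"
  unfolding additive_def
proof (intro ballI impI blinfun_eqI)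
  fix A B x assume "A \<in> M" "B \<in> M" "A \<inter> B = {}"
  have "disjoint_family (binaryset A B)" "range (binaryset A B) \<subseteq> M"
    using M \<open>A \<in> M\<close> \<open>B \<in> M\<close> \<open>A \<inter> B = {}\<close>
    by (auto simp: disjoint_family_on_def binaryset_def)
  then have "(\<lambda>n. blinfun_apply (\<mu> (binaryset A B n)) x) sums blinfun_apply (\<mu> (A \<union> B)) x"
    using \<mu> unfolding i_measure_def by (metis UN_binaryset_eq)
  moreover have "(\<lambda>n. blinfun_apply (\<mu> (binaryset A B n)) x)
      sums (\<Sum>n<2. blinfun_apply (\<mu> (binaryset A B n)) x)"
    by (rule sums_finite) (auto simp: binaryset_def i_measure_empty[OF \<mu> M])
  ultimately show "blinfun_apply (\<mu> (A \<union> B)) x = blinfun_apply (\<mu> A + \<mu> B) x"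
    using sums_unique2 by (fastforce simp: numeral_2_eq_2 binaryset_def blinfun.add_left)
qed

theorem theorem4p4:
  fixes scaleE :: "'k::real_normed_field \<Rightarrow> 'a::banach \<Rightarrow> 'a"
    and scaleF :: "'k \<Rightarrow> 'b::banach \<Rightarrow> 'b"
    and Z :: "'z set"
    and M :: "'z set set"
    and \<mu> :: "'z set \<Rightarrow> 'a \<Rightarrow>\<^sub>L 'b"
  assumes "banach_space_over scaleE"
    and "banach_space_over scaleF"
    and "sigma_algebra Z M"
    and "i_measure scaleE scaleF M \<mu>"
  shows "total_semivariation M \<mu> < \<infinity>"
proof -
  interpret sigma_algebra Z M by fact
  have "bounded (semivariation_sums M \<mu> Z)"
  proof (rule bounded_semivariation_sums)
    show "additive M \<mu>"
      using i_measure_additive assms(4) by blast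
    show "\<forall>A :: nat \<Rightarrow> 'z set. range A \<subseteq> M \<and> disjoint_family A \<longrightarrow>
      independently_convergent (\<lambda>n. \<mu> (A n))"
      using assms(4) unfolding i_measure_def by blast
  qed (rule algebra_axioms)
  then obtain C where C: "\<And>v. v \<in> semivariation_sums M \<mu> Z \<Longrightarrow> norm v \<le> C"
    unfolding bounded_iff by blast
  have "total_semivariation M \<mu> \<le> ennreal C"
    unfolding total_semivariation_def
  proof (rule Sup_least, clarify)
    fix N A and x :: "nat \<Rightarrow> 'a"
    assume "\<forall>n<N. A n \<in> M" "disjoint_family_on A {..<N}" "\<forall>n<N. norm (x n) \<le> 1"
    \<comment> \<open>The index set is \<open>I = {..<N}\<close>, and sets of \<open>M\<close> lie
      in \<open>Z\<close>; thus one constant \<open>C\<close> bounds every member of the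
      supremum.\<close>
    then have "(\<Sum>n<N. blinfun_apply (\<mu> (A n)) (x n)) \<in> semivariation_sums M \<mu> Z"
      using sets_into_space by (intro semivariation_sumsI) auto
    then show "ennreal (norm (\<Sum>n<N. blinfun_apply (\<mu> (A n)) (x n))) \<le> ennreal C"
      by (intro ennreal_leI C)
  qed
  then show ?thesis
    using le_less_trans ennreal_less_top by (metis infinity_ennreal_def)
qed

end
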